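(* Let $\varphi$ be an analytic univalent function on $\mathbb{D}$ with positive real part and $\varphi(0)=1$, such that for every $0\le r<1$ \[ \varphi(-r)=\min_{|z|=r}|\varphi(z)|,\qquad \varphi(r)=\max_{|z|=r}|\varphi(z)|. \] If $f\in\mathcal{K}_s(\varphi)$, then for all $z\in\mathbb{D}$, with $r=|z|<1$, \[ \frac{\varphi(-r)}{1+r^2}\leq |f'(z)|\leq\frac{\varphi(r)}{1-r^2} \] and \[ \int_0^r\frac{\varphi(-t)}{1+t^2}\,dt\leq |f(z)|\leq\int_0^r\frac{\varphi(t)}{1-t^2}\,dt. \] These inequalities are sharp: for every $0\le r<1$, each of the four bounds is attained by some $f\in\mathcal{K}_s(\varphi)$ at some point $z$ with $|z|=r$.
   Context: $\mathbb{D}=\{z\in\mathbb{C}:|z|<1\}$. $\mathcal{A}$ is the class of analytic functions $f$ on $\mathbb{D}$ with $f(0)=0$ and $f'(0)=1$. $S^*(1/2)$ is the class of functions $g\in\mathcal{A}$ that are starlike of order $1/2$, i.e. $\operatorname{Re}(zg'(z)/g(z))>1/2$ for all $z\in\mathbb{D}$ (the quotient taking the value $1$ at $z=0$). Subordination: for $p,q$ analytic in $\mathbb{D}$, $p\prec q$ means that there is an analytic function $w$ on $\mathbb{D}$ with $w(0)=0$ and $|w(z)|<1$ such that $p(z)=q(w(z))$ for all $z\in\mathbb{D}$. For a function $\varphi$ analytic on $\mathbb{D}$ with positive real part, $\mathcal{K}_s(\varphi)$ is the class of functions $f\in\mathcal{A}$ for which there exists $g\in S^*(1/2)$ such that \[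 -\frac{z^2f'(z)}{g(z)g(-z)}\prec\varphi(z)\quad(z\in\mathbb{D}), \] where the left-hand side is extended to $z=0$ by its limit value $1$. *)

theory Defs
  imports "HOL-Complex_Analysis.Complex_Analysis"
begin

definition normalized_class :: "(complex \<Rightarrow> complex) set" where
  "normalized_class = {f. f holomorphic_on ball 0 1 \<and> f 0 = 0 \<and> deriv f 0 = 1}"

text \<open>
  Division by zero yields zero, so for \<open>\<alpha> \<ge> 0\<close> the inequality below forces \<open>g z \<noteq> 0\<close>
  for \<open>z \<noteq> 0\<close>, as it does on paper, where \<open>z g'(z) / g(z)\<close> has a pole at any other zero of \<open>g\<close>.
\<close>

definition starlike_of_order :: "real \<Rightarrow> (complex \<Rightarrow> complex) set" where
  "starlike_of_order \<alpha> =
     {g \<in> normalized_class.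
        \<forall>z\<in>ball 0 1. Re (if z = 0 then 1 else z * deriv g z / g z) > \<alpha>}"

text \<open>
  The analyticity of \<open>p\<close> is not part of the definition: if \<open>q\<close> is analytic on the disc, then
  \<open>p = q \<circ> w\<close> is analytic there as well.
\<close>

definition subordinate :: "(complex \<Rightarrow> complex) \<Rightarrow> (complex \<Rightarrow> complex) \<Rightarrow> bool"
    (infix "\<prec>\<^sub>s" 50) where
  "p \<prec>\<^sub>s q \<longleftrightarrow>
     (\<exists>w. w holomorphic_on ball 0 1 \<and> w 0 = 0 \<and>
          (\<forall>z\<in>ball 0 1. cmod (w z) < 1) \<and> (\<forall>z\<in>ball 0 1. p z = q (w z)))"

definition Ks_class :: "(complex \<Rightarrow> complex) \<Rightarrow> (complex \<Rightarrow> complex) set" where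
  "Ks_class \<phi> =
     {f \<in> normalized_class. \<exists>g\<in>starlike_of_order (1/2).
        (\<lambda>z. if z = 0 then 1 else - (z\<^sup>2 * deriv f z / (g z * g (-z)))) \<prec>\<^sub>s \<phi>}"

end

theory Submission
  imports Defs
begin

text \<open>
  For \<open>g\<close> starlike of order 1/2, \<open>G z = - g z g (- z) / z = z Q z\<close> is an odd starlike function, so
  \<open>z G' / G\<close> is an even function of positive real part; the Schwarz lemma for a double zero bounds
  its real part and integrating along radii bounds \<open>Q\<close>. Subordination gives \<open>f' = (\<phi> \<circ> w) Q\<close> with
  \<open>|w z| \<le> |z|\<close>, and the bounds on \<open>f'\<close> follow from the maximum principle for \<open>\<phi>\<close> and \<open>1 / \<phi>\<close>.

  The lower bound on \<open>|f|\<close> rests on the injectivity of the close-to-convex function \<open>f\<close>. If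
  \<open>f a = f b = c\<close> with \<open>a \<noteq> b\<close>, consider the solutions of \<open>f z + t G z = c\<close> for \<open>t \<ge> 0\<close>: each solution
  moves towards the origin as \<open>t\<close> grows, two distinct solutions never meet, and for large \<open>t\<close> the
  solutions lie in a small disc around \<open>0\<close> where \<open>f + t G\<close> is injective. So the set of \<open>t\<close> with two distinct
  solutions has a largest element, and moving both solutions slightly further contradicts this.
\<close>

section \<open>Injectivity of close-to-convex functions\<close>

text \<open>The Noshiro-Warschawski criterion, with \<open>k\<close> rotating the half-plane. After
  division by \<open>k * (z2 - z1)\<close>, the mean value theorem for the real part along the
  segment turns two points of equal value into a zero of \<open>Re (deriv f u / k)\<close>.\<close>

lemma Re_deriv_pos_imp_inj_on:
  assumes "convex S" "open S" "f holomorphic_on S"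
    and pos: "\<And>z. z \<in> S \<Longrightarrow> Re (deriv f z / k) > 0"
  shows "inj_on f S"
proof (rule inj_onI, rule ccontr)
  fix z1 z2 assume z: "z1 \<in> S" "z2 \<in> S" "f z1 = f z2" "z1 \<noteq> z2"
  define F where "F = (\<lambda>z. f z / (k * (z2 - z1)))"
  have sub: "closed_segment z1 z2 \<subseteq> S"
    using assms(1) z by (simp add: closed_segment_subset)
  have der: "(F has_field_derivative deriv f u / (k * (z2 - z1))) (at u)"
    if "u \<in> closed_segment z1 z2" for u
    unfolding F_def using that sub by (intro DERIV_cdivide holomorphic_derivI[OF assms(3,2)]) auto
  obtain u where u: "u \<in> closed_segment z1 z2"
    "Re (F z2) - Re (F z1) = Re (deriv f u / (k * (z2 - z1)) * (z2 - z1))"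
    using complex_mvt_line[of z1 z2 F "\<lambda>u. deriv f u / (k * (z2 - z1))"] der by blast
  then have "Re (deriv f u / k) = 0"
    using z by (simp add: F_def)
  then show False
    using pos[of u] u sub by auto
qed

text \<open>Serves two purposes: the sign of this derivative shows that a preimage moves inward, and
  its bound by \<open>cmod v\<close> compares the modulus of a curve with its length.\<close>

lemma DERIV_cmod_curve:
  assumes "(\<gamma> has_vector_derivative v) (at s)" "\<gamma> s \<noteq> 0"
  shows "((\<lambda>s. cmod (\<gamma> s)) has_real_derivative Re (cnj (\<gamma> s) * v) / cmod (\<gamma> s)) (at s)"
proof -
  have 1: "((\<lambda>s. Re (\<gamma> s)) has_real_derivative Re v) (at s)"
    and 2: "((\<lambda>s. Im (\<gamma> s)) has_real_derivative Im v) (at s)"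
    using bounded_linear.has_vector_derivative[OF bounded_linear_Re assms(1)]
      bounded_linear.has_vector_derivative[OF bounded_linear_Im assms(1)]
    by (simp_all add: has_real_derivative_iff_has_vector_derivative)
  have pos: "(Re (\<gamma> s))\<^sup>2 + (Im (\<gamma> s))\<^sup>2 > 0"
    using assms(2) by (simp add: complex_neq_0)
  have "((\<lambda>s. (Re (\<gamma> s))\<^sup>2 + (Im (\<gamma> s))\<^sup>2) has_real_derivative 2 * Re (cnj (\<gamma> s) * v)) (at s)"
    by (auto intro!: derivative_eq_intros assms(1) simp: algebra_simps)
  from DERIV_chain2[OF DERIV_real_sqrt[OF pos] this]
  have "((\<lambda>s. cmod (\<gamma> s)) has_real_derivative inverse (cmod (\<gamma> s)) / 2 * (2 * Re (cnj (\<gamma> s) * v))) (at s)"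
    by (simp only: cmod_def)
  moreover have "inverse x / 2 * (2 * y) = y / x" for x y :: real
    by (simp add: field_simps)
  ultimately show ?thesis by (simp only:)
qed

text \<open>Moving \<open>T\<close> in the positive real direction moves the preimage of \<open>T a\<close> towards the origin,
  because \<open>a\<close> and \<open>1 / T' a\<close> enclose an obtuse angle.\<close>

lemma level_point_moves_inward:
  assumes "T holomorphic_on S" "open S" "a \<in> S"
    and neg: "Re (a * deriv T a) < 0" and "\<eta> > 0"
  shows "\<exists>e>0. \<forall>s. 0 < s \<and> s < e \<longrightarrow>
    (\<exists>b\<in>S. cmod b < cmod a \<and> cmod (b - a) < \<eta> \<and> T b = T a + of_real s)"
proof -
  have dnz: "deriv T a \<noteq> 0" and anz: "a \<noteq> 0" using neg by auto
  obtain r where r: "r > 0" "ball a r \<subseteq> S" "open (T ` ball a r)" "inj_on T (ball a r)"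
    using has_complex_derivative_locally_invertible[OF assms(1,3,2) dnz] by blast
  have holb: "T holomorphic_on ball a r" using assms(1) r(2) holomorphic_on_subset by blast
  obtain g where g: "g holomorphic_on T ` ball a r"
    "\<And>z. z \<in> ball a r \<Longrightarrow> deriv T z * deriv g (T z) = 1" "\<And>z. z \<in> ball a r \<Longrightarrow> g (T z) = z"
    using holomorphic_has_inverse[OF holb open_ball r(4)] by metis
  \<comment> \<open>The preimage of \<open>T a + s\<close> under the local inverse \<open>g\<close>;
    it starts at \<open>a\<close> with velocity \<open>1 / deriv T a\<close>.\<close>
  define \<gamma> where "\<gamma> = (\<lambda>s::real. g (T a + of_real s))"
  have \<gamma>0: "\<gamma> 0 = a" using g(3)[of a] r(1) by (simp add: \<gamma>_def)
  have "deriv g (T a) = 1 / deriv T a"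
    using g(2)[of a] r(1) dnz by (simp add: field_simps)
  then have dg: "(g has_field_derivative 1 / deriv T a) (at (T a))"
    using holomorphic_derivI[OF g(1) r(3), of "T a" UNIV] r(1) by simp
  have "((\<lambda>s::real. T a + of_real s) has_vector_derivative 1) (at 0)"
    by (auto intro!: derivative_eq_intros)
  then have d\<gamma>: "(\<gamma> has_vector_derivative (1 / deriv T a)) (at 0)"
    using field_vector_diff_chain_at[of "\<lambda>s::real. T a + of_real s" 1 0 g "1 / deriv T a"] dg
    by (simp add: \<gamma>_def o_def)
  \<comment> \<open>The product \<open>cnj a * (1 / deriv T a)\<close> is a positive multiple of
    \<open>inverse w\<close>, and inversion keeps the sign of the real part. So \<open>neg\<close>
    makes the derivative of \<open>cmod (\<gamma> s)\<close> negative at 0.\<close>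
  define w where "w = a * deriv T a"
  have "cnj a * (1 / deriv T a) = of_real ((cmod a)\<^sup>2) * inverse w"
    using dnz anz by (simp add: complex_norm_square field_simps w_def del: of_real_power)
  then have "Re (cnj a * (1 / deriv T a)) = (cmod a)\<^sup>2 * (Re w / (cmod w)\<^sup>2)"
    by (simp add: cmod_power2 del: of_real_power)
  also have "\<dots> < 0"
    using neg dnz anz by (intro mult_pos_neg divide_neg_pos) (auto simp: w_def)
  finally have "Re (cnj (\<gamma> 0) * (1 / deriv T a)) / cmod (\<gamma> 0) < 0"
    using anz unfolding \<gamma>0 by (simp add: divide_neg_pos)
  from DERIV_neg_dec_right[OF DERIV_cmod_curve[OF d\<gamma>] this]
  obtain d where d: "d > 0" "\<And>h. 0 < h \<Longrightarrow> h < d \<Longrightarrow> cmod (\<gamma> h) < cmod a"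
    using \<gamma>0 anz by auto
  have "isCont \<gamma> 0" using d\<gamma> by (rule has_vector_derivative_continuous)
  then obtain d2 where d2: "d2 > 0" "\<And>h. \<bar>h\<bar> < d2 \<Longrightarrow> cmod (\<gamma> h - a) < \<eta>"
    using \<open>\<eta> > 0\<close> \<gamma>0 by (force simp: continuous_at_eps_delta dist_norm)
  obtain d3 where d3: "d3 > 0" "ball (T a) d3 \<subseteq> T ` ball a r"
    using r(1,3) by (metis centre_in_ball imageI openE)
  show ?thesis
  proof (intro exI[of _ "min d (min d2 d3)"] conjI allI impI)
    fix s assume s: "0 < s \<and> s < min d (min d2 d3)"
    then have "T a + of_real s \<in> ball (T a) d3" by (simp add: dist_norm)
    with d3 obtain b where b: "b \<in> ball a r" "T b = T a + of_real s" by (metis imageE subsetD)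
    then have "b = \<gamma> s" using g(3) by (simp add: \<gamma>_def flip: b(2))
    then show "\<exists>b\<in>S. cmod b < cmod a \<and> cmod (b - a) < \<eta> \<and> T b = T a + of_real s"
      using b r(2) d(2)[of s] d2(2)[of s] s by auto
  qed (use d d2 d3 in auto)
qed

text \<open>With \<open>G z = z * Q z\<close>, the last hypothesis is
  \<open>Re (z * G' z / G z) > 0\<close>, starlikeness of \<open>G\<close>, and the one before it is
  \<open>Re (z * deriv f z / G z) > 0\<close>, close-to-convexity of \<open>f\<close> with respect
  to \<open>G\<close>.\<close>

lemma close_to_convex_imp_inj_on:
  assumes f: "f holomorphic_on ball 0 1" and Q: "Q holomorphic_on ball 0 1"
    and Q0: "\<And>z. z \<in> ball 0 1 \<Longrightarrow> Q z \<noteq> 0"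
    and posf: "\<And>z. z \<in> ball 0 1 \<Longrightarrow> Re (deriv f z / Q z) > 0"
    and posQ: "\<And>z. z \<in> ball 0 1 \<Longrightarrow> Re (1 + z * deriv Q z / Q z) > 0"
  shows "inj_on f (ball 0 1)"
proof (rule inj_onI, rule ccontr)
  fix a0 b0 assume ab0: "a0 \<in> ball 0 1" "b0 \<in> ball 0 1" "f a0 = f b0" "a0 \<noteq> b0"
  define c where "c = f a0"
  define G where "G = (\<lambda>z. z * Q z)"
  define F where "F = (\<lambda>t z. f z + of_real t * G z)"
  define G' where "G' = (\<lambda>z. Q z + z * deriv Q z)"
  note df = holomorphic_derivI[OF f open_ball, of _ UNIV, simplified]
  have dG: "(G has_field_derivative G' z) (at z)" if "cmod z < 1" for z
    unfolding G_def G'_def using that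
    by (auto intro!: derivative_eq_intros holomorphic_derivI[OF Q open_ball])
  have dF: "(F t has_field_derivative deriv f z + of_real t * G' z) (at z)" if "cmod z < 1" for z t
    unfolding F_def using that by (auto intro!: derivative_eq_intros df dG)
  have posG: "Re (G' z / Q z) > 0" if "z \<in> ball 0 1" for z
    using posQ[OF that] Q0[OF that] by (simp add: G'_def add_divide_distrib)
  have Fhol: "F t holomorphic_on ball 0 1" for t
    using dF holomorphic_on_open[of "ball 0 1"] by fastforce
  have local_inj: "\<exists>\<delta>>0. ball a \<delta> \<subseteq> ball 0 1 \<and> (\<forall>t\<ge>0. inj_on (F t) (ball a \<delta>))"
    if a: "a \<in> ball 0 1" for a
  proof -
    \<comment> \<open>Freezing the denominator at \<open>Q a\<close> leaves both real parts positive
      near \<open>a\<close> by continuity. Since the derivative of \<open>F t\<close> is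
      \<open>deriv f + t * G'\<close>, a single radius then serves all \<open>t\<close> \<ge>
      0.\<close>
    define U where "U = ball 0 1 \<inter> (\<lambda>z. Re (deriv f z / Q a)) -` {0<..} \<inter> 
       (ball 0 1 \<inter> (\<lambda>z. Re (G' z / Q a)) -` {0<..})"
    have "open U"
      unfolding U_def G'_def using f Q Q0[OF a]
      by (intro open_Int continuous_open_preimage continuous_intros holomorphic_on_imp_continuous_on
            holomorphic_deriv) auto
    moreover have "a \<in> U" using a posf[OF a] posG[OF a] by (auto simp: U_def)
    ultimately obtain \<delta> where \<delta>: "\<delta> > 0" "ball a \<delta> \<subseteq> U" by (meson openE)
    have "inj_on (F t) (ball a \<delta>)" if t: "t \<ge> 0" for t
    proof (rule Re_deriv_pos_imp_inj_on[where k = "Q a"])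
      show "F t holomorphic_on ball a \<delta>"
        using \<delta> by (intro holomorphic_on_subset[OF Fhol]) (auto simp: U_def)
      fix z assume "z \<in> ball a \<delta>"
      then have z: "cmod z < 1" "Re (deriv f z / Q a) > 0" "Re (G' z / Q a) > 0"
        using \<delta> by (auto simp: U_def)
      have "deriv (F t) z / Q a = deriv f z / Q a + of_real t * (G' z / Q a)"
        using DERIV_imp_deriv[OF dF[OF z(1)]] by (simp add: add_divide_distrib)
      then show "Re (deriv (F t) z / Q a) > 0"
        using z t by (simp add: add_pos_nonneg del: Re_divide times_divide_eq_right)
    qed auto
    with \<delta> show ?thesis by (auto simp: U_def)
  qed
  have step: "\<exists>e>0. \<forall>s. 0 < s \<and> s < e \<longrightarrow>
      (\<exists>b. cmod b \<le> cmod a \<and> cmod (b - a) < \<eta> \<and> F (t + s) b = c)"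
    if a: "a \<in> ball 0 1" and t: "t \<ge> 0" and Fa: "F t a = c" and "\<eta> > 0" for a t \<eta>
  proof (cases "a = 0")
    \<comment> \<open>\<open>G\<close> vanishes at 0, so a solution at the origin stays there for
      every parameter; this is why the modulus in \<open>step\<close> is bounded only
      weakly.\<close>
    case True
    then have "F (t + s) 0 = c" for s using Fa by (simp add: F_def G_def)
    then show ?thesis using True \<open>\<eta> > 0\<close> by (intro exI[of _ 1]) (auto intro!: exI[of _ 0])
  next
    case False
    \<comment> \<open>Away from 0 the equation \<open>F t z = c\<close> reads
      \<open>T z = t\<close>, so increasing \<open>t\<close> moves the value of \<open>T\<close> in
      the positive real direction. At a solution, \<open>a * deriv T a\<close> is minus the sum of
      \<open>deriv f a / Q a\<close> and \<open>t * (G' a / Q a)\<close>, hence has negative real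
      part.\<close>
    define T where "T = (\<lambda>z. (c - f z) / G z)"
    have Gnz: "G z \<noteq> 0" if "z \<in> ball 0 1 - {0}" for z using that Q0[of z] by (auto simp: G_def)
    have Ta: "c - f a = of_real t * G a" using Fa by (auto simp: F_def)
    then have Ta': "T a = of_real t" using a False Gnz by (simp add: T_def)
    have "(T has_field_derivative ((- deriv f a) * G a - (c - f a) * G' a) / (G a * G a)) (at a)"
      unfolding T_def using a False Gnz by (auto intro!: derivative_eq_intros df dG)
    also have "((- deriv f a) * G a - (c - f a) * G' a) / (G a * G a)
        = - (deriv f a + of_real t * G' a) / G a"
      unfolding Ta using Gnz[of a] a False by (simp add: field_simps)
    finally have "a * deriv T a = - (deriv f a / Q a + of_real t * (G' a / Q a))"
      using False Q0[OF a] by (simp add: DERIV_imp_deriv G_def field_simps)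
    then have neg: "Re (a * deriv T a) < 0"
      using posf[OF a] posG[OF a] t
      by (simp add: add_pos_nonneg del: Re_divide times_divide_eq_right minus_add_distrib)
    have "T holomorphic_on ball 0 1 - {0}"
      unfolding T_def G_def using Gnz unfolding G_def
      by (intro holomorphic_intros holomorphic_on_subset[OF f] holomorphic_on_subset[OF Q]) auto
    from level_point_moves_inward[OF this _ _ neg \<open>\<eta> > 0\<close>] obtain e where e: "e > 0"
      "\<And>s. 0 < s \<Longrightarrow> s < e \<Longrightarrow> \<exists>b\<in>ball 0 1 - {0}. cmod b < cmod a \<and> cmod (b - a) < \<eta> \<and> T b = T a + of_real s"
      using a False by (auto simp: open_delete)
    show ?thesis
    proof (intro exI[of _ e] conjI allI impI)
      fix s assume "0 < s \<and> s < e"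
      then obtain b where b: "b \<in> ball 0 1 - {0}" "cmod b < cmod a" "cmod (b - a) < \<eta>" "T b = of_real (t + s)"
        using e(2)[of s] unfolding Ta' of_real_add by blast
      then have "c - f b = of_real (t + s) * G b"
        using Gnz[of b] by (simp add: T_def field_simps)
      then show "\<exists>b. cmod b \<le> cmod a \<and> cmod (b - a) < \<eta> \<and> F (t + s) b = c"
        using b by (intro exI[of _ b]) (auto simp: F_def algebra_simps)
    qed (use e in auto)
  qed
  \<comment> \<open>Solutions only move inward, so this closed disc keeps containing them and
    supplies the compactness for the limit argument.\<close>
  define \<rho> where "\<rho> = max (cmod a0) (cmod b0)"
  have \<rho>: "\<rho> < 1" "cball 0 \<rho> \<subseteq> ball (0::complex) 1" using ab0 by (auto simp: \<rho>_def)
  define S where "S = {t. t \<ge> 0 \<and> (\<exists>a b. a \<in> cball 0 \<rho> \<and> b \<in> cball 0 \<rho> \<and> a \<noteq> b \<and> F t a = c \<and> F t b = c)}"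
  have "a0 \<in> cball 0 \<rho> \<and> b0 \<in> cball 0 \<rho> \<and> a0 \<noteq> b0 \<and> F 0 a0 = c \<and> F 0 b0 = c"
    using ab0 by (simp add: F_def c_def \<rho>_def)
  then have "0 \<in> S" unfolding S_def by blast
  have contf: "continuous_on (ball 0 1) f" using f by (rule holomorphic_on_imp_continuous_on)
  have contG: "continuous_on (ball 0 1) G"
    unfolding G_def by (intro continuous_intros holomorphic_on_imp_continuous_on Q)
  have "bdd_above S"
  proof -
    obtain \<delta> where \<delta>: "\<delta> > 0" "\<And>t. t \<ge> 0 \<Longrightarrow> inj_on (F t) (ball 0 \<delta>)"
      using local_inj[of 0] by auto
    have "compact (cball 0 \<rho> - ball (0::complex) \<delta>)" by (simp add: compact_diff)
    moreover have "continuous_on (cball 0 \<rho> - ball (0::complex) \<delta>) (\<lambda>z. (c - f z) / G z)"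
      using \<rho>(2) Q0 \<delta>(1)
      by (intro continuous_intros continuous_on_subset[OF contf] continuous_on_subset[OF contG])
         (auto simp: G_def)
    ultimately have "bounded ((\<lambda>z. (c - f z) / G z) ` (cball 0 \<rho> - ball 0 \<delta>))"
      by (intro compact_imp_bounded compact_continuous_image)
    \<comment> \<open>A solution outside the small disc satisfies
      \<open>t = (c - f a) / G a\<close>, so \<open>t\<close> is at most \<open>K\<close>. For
      larger \<open>t\<close> both solutions lie where \<open>F t\<close> is injective.\<close>
    then obtain K where K: "\<And>z. z \<in> cball 0 \<rho> - ball 0 \<delta> \<Longrightarrow> cmod ((c - f z) / G z) \<le> K"
      unfolding bounded_iff by blast
    have small: "a \<in> ball 0 \<delta>" if "a \<in> cball 0 \<rho>" "F t a = c" "t > max 0 K" for a t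
    proof (rule ccontr)
      assume "a \<notin> ball 0 \<delta>"
      then have a: "a \<in> cball 0 \<rho> - ball 0 \<delta>" "a \<noteq> 0" using that \<delta> by auto
      then have "G a \<noteq> 0" using \<rho>(2) Q0 by (auto simp: G_def)
      then have "(c - f a) / G a = of_real t" using that by (auto simp: F_def)
      with K[OF a(1)] that show False by simp
    qed
    have "t \<le> max 0 K" if tS: "t \<in> S" for t
    proof (rule ccontr)
      assume gt: "\<not> t \<le> max 0 K"
      obtain a b where "a \<in> cball 0 \<rho>" "b \<in> cball 0 \<rho>" "a \<noteq> b" "F t a = c" "F t b = c"
        using tS by (auto simp: S_def)
      with small[of a t] small[of b t] inj_onD[OF \<delta>(2)[of t], of a b] gt show False by (auto simp: le_max_iff_disj)
    qed
    then show ?thesis by (rule bdd_aboveI)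
  qed
  define ts where "ts = Sup S"
  have ts: "t \<le> ts" if "t \<in> S" for t unfolding ts_def by (rule cSup_upper[OF that \<open>bdd_above S\<close>])
  \<comment> \<open>The supremum is attained: pairs of solutions for parameters tending to
    \<open>ts\<close> have a convergent subsequence, whose limits \<open>la\<close> and
    \<open>lb\<close> solve the equation at \<open>ts\<close>.\<close>
  have "\<exists>t\<in>S. ts - 1 / Suc n < t" for n
    unfolding ts_def using \<open>0 \<in> S\<close> by (intro less_cSupD) auto
  then obtain t where t: "\<And>n. t n \<in> S" "\<And>n. ts - 1 / Suc n < t n" by metis
  then obtain a b where ab: "\<And>n. a n \<in> cball 0 \<rho>" "\<And>n. b n \<in> cball 0 \<rho>" "\<And>n. a n \<noteq> b n"
    "\<And>n. F (t n) (a n) = c" "\<And>n. F (t n) (b n) = c"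
    unfolding S_def by (simp, metis)
  have "(\<lambda>n. ts - 1 / Suc n) \<longlonglongrightarrow> ts - 0"
    by (intro tendsto_intros LIMSEQ_Suc[OF lim_1_over_n])
  then have tlim: "t \<longlonglongrightarrow> ts"
    using t ts by (intro tendsto_sandwich[of "\<lambda>n. ts - 1 / Suc n" t sequentially "\<lambda>_. ts"])
       (auto intro!: always_eventually less_imp_le)
  have "seq_compact (cball (0::complex) \<rho> \<times> cball (0::complex) \<rho>)"
    by (simp add: compact_Times flip: compact_eq_seq_compact_metric)
  moreover have "\<forall>n. (a n, b n) \<in> cball 0 \<rho> \<times> cball 0 \<rho>" using ab by auto
  ultimately obtain l k where lk: "l \<in> cball 0 \<rho> \<times> cball 0 \<rho>" "strict_mono (k :: nat \<Rightarrow> nat)"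
    "((\<lambda>n. (a n, b n)) \<circ> k) \<longlonglongrightarrow> l" by (rule seq_compactE)
  obtain la lb where [simp]: "l = (la, lb)" by (cases l)
  have lima: "(\<lambda>n. a (k n)) \<longlonglongrightarrow> la" and limb: "(\<lambda>n. b (k n)) \<longlonglongrightarrow> lb"
    using tendsto_fst[OF lk(3)] tendsto_snd[OF lk(3)] by (simp_all add: o_def)
  have limt: "(\<lambda>n. t (k n)) \<longlonglongrightarrow> ts" using LIMSEQ_subseq_LIMSEQ[OF tlim lk(2)] by (simp add: o_def)
  have inl: "la \<in> ball 0 1" "lb \<in> ball 0 1" using lk(1) \<rho> by auto
  have limF: "(\<lambda>n. F (t (k n)) (x n)) \<longlonglongrightarrow> F ts y" if "x \<longlonglongrightarrow> y" "y \<in> ball 0 1" for x y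
  proof -
    have "isCont f y" "isCont G y"
      using that contf contG by (auto simp: continuous_on_eq_continuous_at)
    then show ?thesis
      unfolding F_def using that limt
      by (intro tendsto_intros isCont_tendsto_compose[of y f] isCont_tendsto_compose[of y G]) auto
  qed
  have Fl: "F ts la = c" "F ts lb = c"
    using limF[OF lima] limF[OF limb] inl ab by (auto dest: LIMSEQ_unique[OF _ tendsto_const])
  have "ts \<ge> 0" using ts[OF \<open>0 \<in> S\<close>] .
  \<comment> \<open>The limits cannot merge: the radius of injectivity around \<open>la\<close> is
    independent of \<open>t\<close>, while the approximating solutions are distinct.\<close>
  have "la \<noteq> lb"
  proof
    assume eq: "la = lb"
    obtain \<delta> where \<delta>: "\<delta> > 0" "\<And>t. t \<ge> 0 \<Longrightarrow> inj_on (F t) (ball la \<delta>)"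
      using local_inj inl by metis
    have "\<forall>\<^sub>F n in sequentially. a (k n) \<in> ball la \<delta> \<and> b (k n) \<in> ball la \<delta>"
      using \<delta>(1) tendstoD[OF lima] tendstoD[OF limb] eq by (auto simp: eventually_conj_iff dist_commute)
    then obtain n where "a (k n) \<in> ball la \<delta>" "b (k n) \<in> ball la \<delta>"
      using eventually_happens' sequentially_bot by blast
    moreover have "t (k n) \<ge> 0" using t(1) by (auto simp: S_def)
    ultimately show False using \<delta>(2) ab by (metis inj_onD)
  qed
  \<comment> \<open>Moving each solution by less than half of their distance keeps the two
    apart.\<close>
  then have \<eta>: "cmod (la - lb) / 2 > 0" by simp
  obtain e1 where e1: "e1 > 0" "\<And>s. 0 < s \<Longrightarrow> s < e1 \<Longrightarrow>
      \<exists>b. cmod b \<le> cmod la \<and> cmod (b - la) < cmod (la - lb) / 2 \<and> F (ts + s) b = c"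
    using step[OF inl(1) \<open>ts \<ge> 0\<close> Fl(1) \<eta>] by auto
  obtain e2 where e2: "e2 > 0" "\<And>s. 0 < s \<Longrightarrow> s < e2 \<Longrightarrow>
      \<exists>b. cmod b \<le> cmod lb \<and> cmod (b - lb) < cmod (la - lb) / 2 \<and> F (ts + s) b = c"
    using step[OF inl(2) \<open>ts \<ge> 0\<close> Fl(2) \<eta>] by auto
  define s where "s = min e1 e2 / 2"
  have s: "0 < s" "s < e1" "s < e2" using e1 e2 by (auto simp: s_def)
  obtain a' b' where a': "cmod a' \<le> cmod la" "cmod (a' - la) < cmod (la - lb) / 2" "F (ts + s) a' = c"
     and b': "cmod b' \<le> cmod lb" "cmod (b' - lb) < cmod (la - lb) / 2" "F (ts + s) b' = c"
    using e1(2)[of s] e2(2)[of s] s by blast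
  have "a' \<noteq> b'"
  proof
    assume "a' = b'"
    then have "cmod (la - lb) \<le> cmod (a' - la) + cmod (b' - lb)"
      by (metis dist_norm dist_triangle3)
    then show False using a' b' by simp
  qed
  moreover have "a' \<in> cball 0 \<rho>" "b' \<in> cball 0 \<rho>" using a' b' lk(1) by auto
  ultimately have "ts + s \<in> S" using a' b' \<open>ts \<ge> 0\<close> s unfolding S_def by fastforce
  then show False using ts[of "ts + s"] s by simp
qed

section \<open>From bounds on the derivative to bounds on the function\<close>

lemma has_integral_radial_deriv:
  assumes f: "f holomorphic_on ball 0 1" and "f 0 = 0" "cmod u = 1" "0 \<le> r" "r < 1"
  shows "((\<lambda>t. u * deriv f (of_real t * u)) has_integral f (of_real r * u)) {0..r}"
proof -
  have "((\<lambda>t. f (of_real t * u)) has_vector_derivative u * deriv f (of_real t * u)) (at t within {0..r})"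
    if "t \<in> {0..r}" for t
  proof -
    have "((\<lambda>t::real. of_real t * u) has_vector_derivative u) (at t)"
      by (auto intro!: derivative_eq_intros)
    moreover have "(f has_field_derivative deriv f (of_real t * u)) (at (of_real t * u))"
      using that assms by (intro holomorphic_derivI[OF f open_ball]) (auto simp: norm_mult)
    ultimately show ?thesis
      using field_vector_diff_chain_at[of "\<lambda>t::real. of_real t * u" u t f]
      by (auto simp: o_def intro: has_vector_derivative_at_within)
  qed
  from fundamental_theorem_of_calculus[OF \<open>0 \<le> r\<close> this] show ?thesis
    using \<open>f 0 = 0\<close> by simp
qed

lemma cmod_le_integral_radial:
  assumes f: "f holomorphic_on ball 0 1" "f 0 = 0"
    and M: "continuous_on {0..<1} M"
    and le: "\<And>z. cmod z < 1 \<Longrightarrow> cmod (deriv f z) \<le> M (cmod z)"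
    and z: "cmod z < 1"
  shows "cmod (f z) \<le> integral {0..cmod z} M"
proof (cases "z = 0")
  case False
  define u where "u = z / of_real (cmod z)"
  have u: "cmod u = 1" "of_real (cmod z) * u = z"
    using False by (simp_all add: u_def norm_divide)
  note I = has_integral_radial_deriv[OF f u(1) norm_ge_zero z, unfolded u(2)]
  have "norm (integral {0..cmod z} (\<lambda>t. u * deriv f (of_real t * u))) \<le> integral {0..cmod z} M"
  proof (rule integral_norm_bound_integral)
    show "M integrable_on {0..cmod z}"
      using z by (intro integrable_continuous_real continuous_on_subset[OF M]) auto
    show "norm (u * deriv f (of_real t * u)) \<le> M t" if "t \<in> {0..cmod z}" for t
      using le[of "of_real t * u"] that z u(1) by (simp add: norm_mult)
  qed (use I in blast)
  then show ?thesis unfolding integral_unique[OF I] .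
qed (use f in simp)

text \<open>Used for sharpness: where \<open>deriv f\<close> is real and nonnegative along a whole
  radius, nothing cancels in the radial integral.\<close>

lemma cmod_eq_integral_radial:
  assumes f: "f holomorphic_on ball 0 1" "f 0 = 0" and u: "cmod u = 1" and r: "0 \<le> r" "r < 1"
    and m: "continuous_on {0..<1} m"
    and eq: "\<And>t. 0 \<le> t \<Longrightarrow> t < 1 \<Longrightarrow> deriv f (of_real t * u) = of_real (m t)"
    and nonneg: "\<And>t. 0 \<le> t \<Longrightarrow> t < 1 \<Longrightarrow> m t \<ge> 0"
  shows "cmod (f (of_real r * u)) = integral {0..r} m"
proof -
  have "m integrable_on {0..r}"
    using r by (intro integrable_continuous_real continuous_on_subset[OF m]) auto
  from has_integral_linear[OF integrable_integral[OF this] bounded_linear_of_real]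
  have "((\<lambda>t. of_real (m t)) has_integral complex_of_real (integral {0..r} m)) {0..r}"
    by (simp add: o_def)
  from has_integral_mult_right[OF this, of u]
  have "((\<lambda>t. u * deriv f (of_real t * u)) has_integral u * of_real (integral {0..r} m)) {0..r}"
    by (rule has_integral_eq[rotated]) (use eq r in auto)
  from has_integral_unique[OF has_integral_radial_deriv[OF f u r] this]
  have "cmod (f (of_real r * u)) = \<bar>integral {0..r} m\<bar>" by (simp add: norm_mult u)
  also have "\<dots> = integral {0..r} m"
    using nonneg r by (intro abs_of_nonneg Henstock_Kurzweil_Integration.integral_nonneg \<open>m integrable_on {0..r}\<close>) auto
  finally show ?thesis .
qed

text \<open>By injectivity the disc of radius \<open>min |f|\<close> over the circle \<open>|z| = r\<close> is covered by the image of
  \<open>|z| < r\<close>, so the segment from \<open>0\<close> to a minimal value can be pulled back to a curve in the disc.\<close>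

lemma cmod_ge_integral_radial:
  assumes f: "f holomorphic_on ball 0 1" "f 0 = 0" "inj_on f (ball 0 1)"
    and m: "continuous_on {0..<1} m"
    and nonneg: "\<And>t. 0 \<le> t \<Longrightarrow> t < 1 \<Longrightarrow> m t \<ge> 0"
    and ge: "\<And>z. cmod z < 1 \<Longrightarrow> m (cmod z) \<le> cmod (deriv f z)"
    and z: "cmod z < 1"
  shows "integral {0..cmod z} m \<le> cmod (f z)"
proof (cases "z = 0")
  case False
  define r where "r = cmod z"
  have r: "0 < r" "r < 1" using False z by (auto simp: r_def)
  have contf: "continuous_on (ball 0 1) f" using f holomorphic_on_imp_continuous_on by blast
  have sub: "cball 0 r \<subseteq> ball (0::complex) 1" using r by auto
  have "continuous_on (sphere 0 r) (\<lambda>x. cmod (f x))"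
    using r by (intro continuous_intros continuous_on_subset[OF contf]) auto
  moreover have "sphere (0::complex) r \<noteq> {}" using r_def by (auto simp: sphere_def)
  ultimately obtain z0 where z0: "cmod z0 = r" "\<And>x. cmod x = r \<Longrightarrow> cmod (f z0) \<le> cmod (f x)"
    using continuous_attains_inf[of "sphere (0::complex) r" "\<lambda>x. cmod (f x)"] by auto
  define c where "c = f z0"
  have c: "c \<noteq> 0" using f(2) inj_onD[OF f(3), of z0 0] z0 r by (auto simp: c_def)
  obtain g where g: "g holomorphic_on f ` ball 0 1"
    "\<And>z. z \<in> ball 0 1 \<Longrightarrow> deriv f z * deriv g (f z) = 1" "\<And>z. z \<in> ball 0 1 \<Longrightarrow> g (f z) = z"
    using holomorphic_has_inverse[OF f(1) open_ball f(3)] by metis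
  have "f holomorphic_on ball 0 r" "inj_on f (ball 0 r)"
    using r by (auto intro!: holomorphic_on_subset[OF f(1)] inj_on_subset[OF f(3)])
  then have op: "open (f ` ball 0 1)" "open (f ` ball 0 r)"
    using f open_mapping_thm3 open_ball by blast+
  \<comment> \<open>Otherwise the connected ball, which meets the open image at 0, would contain a
    frontier point of it. Such a point is the image of some \<open>x\<close> with
    \<open>cmod x = r\<close>, where \<open>cmod (f x)\<close> is at least
    \<open>cmod c\<close>.\<close>
  have cover: "ball 0 (cmod c) \<subseteq> f ` ball 0 r"
  proof (rule ccontr)
    assume "\<not> ball 0 (cmod c) \<subseteq> f ` ball 0 r"
    moreover have "0 \<in> ball 0 (cmod c) \<inter> f ` ball 0 r"
      using c r f(2) by (auto intro!: image_eqI[of _ _ 0])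
    ultimately have "ball 0 (cmod c) \<inter> frontier (f ` ball 0 r) \<noteq> {}"
      using connected_Int_frontier[OF connected_ball, of 0 "cmod c" "f ` ball 0 r"] by blast
    then obtain y where y: "cmod y < cmod c" "y \<in> closure (f ` ball 0 r)" "y \<notin> f ` ball 0 r"
      using op(2) by (auto simp: frontier_def interior_open)
    have "closed (f ` cball 0 r)"
      by (intro compact_imp_closed compact_continuous_image continuous_on_subset[OF contf sub]) auto
    then have "closure (f ` ball 0 r) \<subseteq> f ` cball 0 r"
      by (intro closure_minimal image_mono) auto
    then obtain x where "x \<in> cball 0 r" "y = f x" using y by auto
    with y have "cmod x = r" by (force simp: less_le)
    with z0(2)[of x] y \<open>y = f x\<close> show False by (simp add: c_def)
  qed
  have seg: "\<exists>x. x \<in> cball 0 r \<and> f x = of_real s * c" if "0 \<le> s" "s \<le> 1" for s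
  proof (cases "s = 1")
    case True
    then show ?thesis using z0 by (auto simp: c_def)
  next
    case False
    then have "of_real s * c \<in> ball 0 (cmod c)" using that c by (simp add: norm_mult)
    with cover obtain x where "x \<in> ball 0 r" "f x = of_real s * c" by (metis imageE subsetD)
    then show ?thesis by (intro exI[of _ x]) auto
  qed
  define \<gamma> where "\<gamma> = (\<lambda>s::real. g (of_real s * c))"
  have \<gamma>: "cmod (\<gamma> s) \<le> r" "f (\<gamma> s) = of_real s * c" if s: "0 \<le> s" "s \<le> 1" for s
  proof -
    obtain x where x: "x \<in> cball 0 r" "f x = of_real s * c" using seg[OF s] by blast
    then have "\<gamma> s = x" using g(3)[of x] sub by (auto simp: \<gamma>_def)
    with x show "cmod (\<gamma> s) \<le> r" "f (\<gamma> s) = of_real s * c" by auto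
  qed
  have \<gamma>01: "\<gamma> 0 = 0" "\<gamma> 1 = z0"
    using g(3)[of 0] g(3)[of z0] f(2) z0 r by (auto simp: \<gamma>_def c_def)
  have der\<gamma>: "(\<gamma> has_vector_derivative c / deriv f (\<gamma> s)) (at s)" and dnz: "deriv f (\<gamma> s) \<noteq> 0"
    if "0 \<le> s" "s \<le> 1" for s
  proof -
    have in1: "\<gamma> s \<in> ball 0 1" using \<gamma>(1)[OF that] r by simp
    have 1: "deriv f (\<gamma> s) * deriv g (of_real s * c) = 1"
      using g(2)[OF in1] \<gamma>(2)[OF that] by simp
    then show "deriv f (\<gamma> s) \<noteq> 0" by auto
    have "of_real s * c \<in> f ` ball 0 1" using in1 \<gamma>(2)[OF that] by (metis imageI)
    from holomorphic_derivI[OF g(1) op(1) this]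
    have "(g has_field_derivative deriv g (of_real s * c)) (at (of_real s * c))" by simp
    moreover have "((\<lambda>s::real. of_real s * c) has_vector_derivative c) (at s)"
      by (auto intro!: derivative_eq_intros)
    ultimately have "(\<gamma> has_vector_derivative c * deriv g (of_real s * c)) (at s)"
      using field_vector_diff_chain_at[of "\<lambda>s::real. of_real s * c" c s g] by (simp add: \<gamma>_def o_def)
    moreover have "c * deriv g (of_real s * c) = c / deriv f (\<gamma> s)"
      using 1 \<open>deriv f (\<gamma> s) \<noteq> 0\<close> by (simp add: field_simps)
    ultimately show "(\<gamma> has_vector_derivative c / deriv f (\<gamma> s)) (at s)" by simp
  qed
  \<comment> \<open>A radius strictly between \<open>r\<close> and 1, so that \<open>M\<close> has a
    two-sided derivative even at \<open>r\<close>.\<close>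
  define R where "R = (1 + r) / 2"
  have R: "r < R" "R < 1" using r by (auto simp: R_def)
  define M where "M = (\<lambda>x. integral {0..x} m)"
  have contm: "continuous_on {0..R} m" using R by (intro continuous_on_subset[OF m]) auto
  have contM: "continuous_on {0..R} M"
    unfolding M_def by (intro indefinite_integral_continuous_1 integrable_continuous_real contm)
  have dM: "(M has_real_derivative m x) (at x)" if "0 < x" "x \<le> r" for x
    using integral_has_real_derivative[OF contm, of x] that R
    by (simp add: M_def at_within_Icc_at)
  \<comment> \<open>Its derivative is nonnegative: the modulus of \<gamma> grows at most at the rate
    \<open>cmod v\<close>, and \<open>m (cmod (\<gamma> s)) * cmod v\<close> is at most
    \<open>cmod (deriv f (\<gamma> s)) * cmod v = cmod c\<close>. Comparing \<open>A 0\<close> with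
    \<open>A 1\<close> gives the bound even if the modulus of \<gamma> is not monotone.\<close>
  define A where "A = (\<lambda>s. s * cmod c - M (cmod (\<gamma> s)))"
  have "A 0 \<le> A 1"
  proof (rule DERIV_nonneg_imp_increasing_open[where f = A])
    fix s :: real assume s: "0 < s" "s < 1"
    have nz: "\<gamma> s \<noteq> 0" using \<gamma>(2)[of s] s c f(2) by auto
    define v where "v = c / deriv f (\<gamma> s)"
    have le: "cmod (\<gamma> s) \<le> r" using \<gamma> s by simp
    let ?D = "Re (cnj (\<gamma> s) * v) / cmod (\<gamma> s)"
    have "((\<lambda>s. cmod (\<gamma> s)) has_real_derivative ?D) (at s)"
      unfolding v_def using s nz by (intro DERIV_cmod_curve der\<gamma>) auto
    from DERIV_chain2[OF dM this] nz le
    have dA: "(A has_real_derivative cmod c - m (cmod (\<gamma> s)) * ?D) (at s)"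
      unfolding A_def by (auto intro!: derivative_eq_intros)
    have "Re (cnj (\<gamma> s) * v) \<le> cmod (\<gamma> s) * cmod v"
      by (metis complex_Re_le_cmod complex_mod_cnj norm_mult)
    then have "?D \<le> cmod v" using nz by (simp add: field_simps)
    then have "m (cmod (\<gamma> s)) * ?D \<le> m (cmod (\<gamma> s)) * cmod v"
      using nonneg[of "cmod (\<gamma> s)"] le r by (intro mult_left_mono) auto
    also have "\<dots> \<le> cmod (deriv f (\<gamma> s)) * cmod v"
      using ge[of "\<gamma> s"] le r by (intro mult_right_mono) auto
    also have "\<dots> = cmod c" using dnz[of s] s by (simp add: v_def norm_divide)
    finally show "\<exists>y. (A has_real_derivative y) (at s) \<and> y \<ge> 0"
      using dA by auto
  next
    have "continuous_on {0..1} \<gamma>"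
      using der\<gamma> by (intro continuous_at_imp_continuous_on ballI has_vector_derivative_continuous) auto
    then have "continuous_on {0..1} (\<lambda>s. M (cmod (\<gamma> s)))"
      using \<gamma>(1) R by (intro continuous_on_compose2[OF contM] continuous_intros) force+
    then show "continuous_on {0..1} A" unfolding A_def by (intro continuous_intros)
  qed simp
  then have "M r \<le> cmod (f z0)" using \<gamma>01 z0(1) by (simp add: A_def M_def c_def)
  also have "\<dots> \<le> cmod (f z)" using z0(2)[of z] by (simp add: r_def)
  finally show ?thesis by (simp add: M_def r_def)
qed (use f in simp)

section \<open>Extremal principles in the disc\<close>

text \<open>The hypotheses concern single circles; the maximum principle for \<phi> and for its
  reciprocal extends them to the closed disc, as required for values \<open>\<phi> (w z)\<close>
  with \<open>cmod (w z)\<close> \<le> \<open>cmod z\<close>.\<close>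

lemma radial_extrema:
  assumes hol: "\<phi> holomorphic_on ball 0 1" and nz: "\<And>z. z \<in> ball 0 1 \<Longrightarrow> \<phi> z \<noteq> 0"
    and least: "\<And>r::real. 0 \<le> r \<Longrightarrow> r < 1 \<Longrightarrow>
           \<phi> (- of_real r) = of_real (LEAST m. m \<in> (\<lambda>z. cmod (\<phi> z)) ` sphere 0 r)"
    and greatest: "\<And>r::real. 0 \<le> r \<Longrightarrow> r < 1 \<Longrightarrow>
           \<phi> (of_real r) = of_real (GREATEST m. m \<in> (\<lambda>z. cmod (\<phi> z)) ` sphere 0 r)"
    and \<zeta>: "cmod \<zeta> \<le> r" and r: "r < 1"
  shows "cmod (\<phi> \<zeta>) \<le> Re (\<phi> (of_real r))" "Re (\<phi> (- of_real r)) \<le> cmod (\<phi> \<zeta>)"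
proof -
  have r0: "0 \<le> r" using \<zeta> norm_ge_zero order_trans by blast
  have cont: "continuous_on (ball 0 1) \<phi>" using hol holomorphic_on_imp_continuous_on by blast
  have cs: "continuous_on (sphere 0 r) (\<lambda>x. cmod (\<phi> x))"
    using r by (intro continuous_intros continuous_on_subset[OF cont]) auto
  have ne: "sphere (0::complex) r \<noteq> {}" using r0 by simp
  obtain zm where zm: "zm \<in> sphere 0 r" "\<And>x. x \<in> sphere 0 r \<Longrightarrow> cmod (\<phi> zm) \<le> cmod (\<phi> x)"
    using continuous_attains_inf[OF compact_sphere ne cs] by blast
  obtain zM where zM: "zM \<in> sphere 0 r" "\<And>x. x \<in> sphere 0 r \<Longrightarrow> cmod (\<phi> x) \<le> cmod (\<phi> zM)"
    using continuous_attains_sup[OF compact_sphere ne cs] by blast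
  \<comment> \<open>By compactness of the circle the extrema are attained, so \<open>LEAST\<close>
    and \<open>GREATEST\<close> denote actual values of the modulus.\<close>
  have m: "Re (\<phi> (- of_real r)) = cmod (\<phi> zm)"
    using least[OF r0 r] Least_equality[of "\<lambda>m. m \<in> (\<lambda>z. cmod (\<phi> z)) ` sphere 0 r" "cmod (\<phi> zm)"] zm
    by fastforce
  have M: "Re (\<phi> (of_real r)) = cmod (\<phi> zM)"
    using greatest[OF r0 r] Greatest_equality[of "\<lambda>m. m \<in> (\<lambda>z. cmod (\<phi> z)) ` sphere 0 r" "cmod (\<phi> zM)"] zM
    by fastforce
  show "cmod (\<phi> \<zeta>) \<le> Re (\<phi> (of_real r))"
    unfolding M
  proof (rule maximum_modulus_frontier[where S = "cball 0 r" and f = \<phi>])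
    show "\<phi> holomorphic_on interior (cball 0 r)"
      using r by (intro holomorphic_on_subset[OF hol]) auto
    show "continuous_on (closure (cball 0 r)) \<phi>"
      using r by (intro continuous_on_subset[OF cont]) auto
  qed (use zM \<zeta> in auto)
  have "cmod (inverse (\<phi> \<zeta>)) \<le> inverse (cmod (\<phi> zm))"
  proof (rule maximum_modulus_frontier[where S = "cball 0 r" and f = "\<lambda>z. inverse (\<phi> z)"])
    show "(\<lambda>z. inverse (\<phi> z)) holomorphic_on interior (cball 0 r)"
      using r nz by (intro holomorphic_intros holomorphic_on_subset[OF hol]) auto
    show "continuous_on (closure (cball 0 r)) (\<lambda>z. inverse (\<phi> z))"
      using r nz by (intro continuous_intros continuous_on_subset[OF cont]) auto
    show "cmod (inverse (\<phi> z)) \<le> inverse (cmod (\<phi> zm))" if "z \<in> frontier (cball 0 r)" for z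
      unfolding norm_inverse using zm nz[of zm] that r by (intro le_imp_inverse_le) auto
  qed (use \<zeta> in auto)
  then show "Re (\<phi> (- of_real r)) \<le> cmod (\<phi> \<zeta>)"
    unfolding m norm_inverse using nz[of \<zeta>] nz[of zm] zm(1) \<zeta> r
    by (simp add: inverse_le_iff_le)
qed

text \<open>Two applications of the Schwarz lemma: the quotient \<open>v\<close> of \<open>w\<close>
  by the identity again maps the disc into itself, and \<open>v 0 = deriv w 0 = 0\<close>.\<close>

lemma Schwarz_second_order:
  assumes w: "w holomorphic_on ball 0 1" "w 0 = 0" "deriv w 0 = 0"
    and lt: "\<And>z. cmod z < 1 \<Longrightarrow> cmod (w z) < 1" and \<xi>: "cmod \<xi> < 1"
  shows "cmod (w \<xi>) \<le> (cmod \<xi>)\<^sup>2"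
proof -
  obtain v where v: "v holomorphic_on ball 0 1" "\<And>z. cmod z < 1 \<Longrightarrow> w z = z * v z" "deriv w 0 = v 0"
    using Schwarz3[OF w(1,2)] by metis
  have v0: "v 0 = 0" using v(3) w(3) by simp
  \<comment> \<open>The second application asks for the strict bound \<open>cmod (v z) < 1\<close>.
    Equality at one point would make \<open>w\<close> a rotation, whose derivative at 0 has modulus
    1.\<close>
  have no_rot: "\<not> (\<exists>\<alpha>. (\<forall>z. cmod z < 1 \<longrightarrow> w z = \<alpha> * z) \<and> cmod \<alpha> = 1)"
  proof
    assume "\<exists>\<alpha>. (\<forall>z. cmod z < 1 \<longrightarrow> w z = \<alpha> * z) \<and> cmod \<alpha> = 1"
    then obtain \<alpha> where \<alpha>: "\<And>z. cmod z < 1 \<Longrightarrow> w z = \<alpha> * z" "cmod \<alpha> = 1" by blast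
    have "(w has_field_derivative \<alpha>) (at 0)"
      by (rule has_field_derivative_transform_within_open[of "\<lambda>z. \<alpha> * z" _ _ "ball 0 1"])
         (auto intro!: derivative_eq_intros simp: \<alpha>(1))
    then show False using w(3) \<alpha>(2) DERIV_imp_deriv by force
  qed
  have "cmod (v z) < 1" if z: "cmod z < 1" for z
  proof (cases "z = 0")
    case False
    have "cmod (w z) \<le> cmod z" using Schwarz_Lemma(1)[OF w(1,2) lt z] .
    moreover have "cmod (w z) \<noteq> cmod z"
      using Schwarz_Lemma(3)[OF w(1,2) lt z] no_rot False z by blast
    ultimately have "cmod z * cmod (v z) < cmod z * 1"
      using v(2)[OF z] by (simp add: norm_mult)
    then show ?thesis by (rule mult_less_cancel_left_pos[THEN iffD1, rotated]) (use False in simp)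
  qed (use v0 in simp)
  from Schwarz_Lemma(1)[OF v(1) v0 this \<xi>] show ?thesis
    using v(2)[OF \<xi>] by (simp add: norm_mult power2_eq_square mult_left_mono)
qed

text \<open>The Cayley transform \<open>(h - 1) / (h + 1)\<close> sends the right half-plane to the
  disc and has a double zero at 0. Its bound by \<open>q = (cmod z)\<^sup>2\<close> confines
  \<open>Re (h z)\<close> between \<open>(1 - q) / (1 + q)\<close> and
  \<open>(1 + q) / (1 - q)\<close>.\<close>

lemma Caratheodory_second_order:
  assumes h: "h holomorphic_on ball 0 1" "h 0 = 1" "deriv h 0 = 0"
    and pos: "\<And>z. cmod z < 1 \<Longrightarrow> Re (h z) > 0" and z: "cmod z < 1"
  shows "- 2 * (cmod z)\<^sup>2 / (1 + (cmod z)\<^sup>2) \<le> Re (h z) - 1"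
    and "Re (h z) - 1 \<le> 2 * (cmod z)\<^sup>2 / (1 - (cmod z)\<^sup>2)"
proof -
  define w where "w = (\<lambda>z. (h z - 1) / (h z + 1))"
  have nz: "h z + 1 \<noteq> 0" if "cmod z < 1" for z
    using pos[OF that] by (auto simp: complex_eq_iff)
  have "w holomorphic_on ball 0 1"
    unfolding w_def using nz h(1) by (intro holomorphic_intros) auto
  moreover have "w 0 = 0" by (simp add: w_def h)
  moreover have "(w has_field_derivative 0) (at 0)"
    using holomorphic_derivI[OF h(1) open_ball, of 0 UNIV] nz[of 0] h(2,3) unfolding w_def
    by (auto intro!: derivative_eq_intros)
  then have "deriv w 0 = 0" by (rule DERIV_imp_deriv)
  moreover have "cmod (w z) < 1" if "cmod z < 1" for z
  proof -
    have "(cmod (h z - 1))\<^sup>2 < (cmod (h z + 1))\<^sup>2"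
      using pos[OF that] unfolding cmod_power2 by (simp add: power2_eq_square algebra_simps)
    then have "cmod (h z - 1) < cmod (h z + 1)" by (rule power_less_imp_less_base) simp
    then show ?thesis using nz[OF that] by (simp add: w_def norm_divide)
  qed
  ultimately have wle: "cmod (w z) \<le> (cmod z)\<^sup>2" using z by (rule Schwarz_second_order)
  define q x where "q = (cmod z)\<^sup>2" and "x = Re (h z)"
  have q: "0 \<le> q" "q < 1" using z by (auto simp: q_def power_less_one_iff abs_square_less_1)
  have "cmod (h z - 1) \<le> q * cmod (h z + 1)"
    using wle nz[OF z] by (simp add: w_def norm_divide q_def field_simps)
  then have "(cmod (h z - 1))\<^sup>2 \<le> q\<^sup>2 * (cmod (h z + 1))\<^sup>2"
    unfolding power_mult_distrib[symmetric] by (rule power_mono) simp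
  then have *: "(x - 1)\<^sup>2 + (Im (h z))\<^sup>2 \<le> q\<^sup>2 * ((x + 1)\<^sup>2 + (Im (h z))\<^sup>2)"
    by (simp add: cmod_power2 x_def)
  have "q\<^sup>2 * (Im (h z))\<^sup>2 \<le> 1 * (Im (h z))\<^sup>2"
    using q by (intro mult_right_mono) (auto simp: power_le_one)
  with * have "(x - 1)\<^sup>2 \<le> q\<^sup>2 * (x + 1)\<^sup>2" by (simp add: algebra_simps)
  then have "(x - 1)\<^sup>2 \<le> (q * (x + 1))\<^sup>2" by (simp add: power_mult_distrib)
  then have "\<bar>x - 1\<bar> \<le> q * (x + 1)"
    using q pos[OF z] by (simp add: abs_le_square_iff x_def abs_of_nonneg flip: abs_le_square_iff)
  then have "1 - q \<le> x * (1 + q)" "x * (1 - q) \<le> 1 + q" by (auto simp: algebra_simps abs_le_iff)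
  then show "- 2 * (cmod z)\<^sup>2 / (1 + (cmod z)\<^sup>2) \<le> Re (h z) - 1"
    "Re (h z) - 1 \<le> 2 * (cmod z)\<^sup>2 / (1 - (cmod z)\<^sup>2)"
    using q unfolding q_def[symmetric] x_def[symmetric] by (auto simp: field_simps)
qed

section \<open>The odd starlike function built from \<open>g\<close>\<close>

text \<open>For \<open>G z = z * Q z\<close>, the quotient \<open>z G' / G\<close> is the sum of the
  values of \<open>z g' / g\<close> at \<open>z\<close> and \<open>- z\<close>, minus 1. Two real
  parts above 1/2 make it positive, and it is even, so the second-order Caratheodory bounds
  apply.\<close>

lemma starlike_half_symmetrized:
  assumes g: "g \<in> starlike_of_order (1/2)"
  obtains Q where "Q holomorphic_on ball 0 1" "Q 0 = 1"
    "\<And>z. z \<in> ball 0 1 \<Longrightarrow> Q z \<noteq> 0"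
    "\<And>z. z \<in> ball 0 1 \<Longrightarrow> g z * g (- z) = - (z\<^sup>2 * Q z)"
    "\<And>z. z \<in> ball 0 1 \<Longrightarrow> Re (1 + z * deriv Q z / Q z) > 0"
    "\<And>z. z \<in> ball 0 1 \<Longrightarrow> 1 / (1 + (cmod z)\<^sup>2) \<le> cmod (Q z)"
    "\<And>z. z \<in> ball 0 1 \<Longrightarrow> cmod (Q z) \<le> 1 / (1 - (cmod z)\<^sup>2)"
proof -
  have holg: "g holomorphic_on ball 0 1" and g0: "g 0 = 0" and g'0: "deriv g 0 = 1"
    and gpos: "\<And>z. cmod z < 1 \<Longrightarrow> z \<noteq> 0 \<Longrightarrow> Re (z * deriv g z / g z) > 1/2"
    using g by (auto simp: starlike_of_order_def normalized_class_def simp del: Re_divide split: if_splits)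
  have gnz: "g z \<noteq> 0" if "cmod z < 1" "z \<noteq> 0" for z using gpos[OF that] by auto
  obtain k where k: "k holomorphic_on ball 0 1" "\<And>z. cmod z < 1 \<Longrightarrow> g z = z * k z" "deriv g 0 = k 0"
    using Schwarz3[OF holg g0] by metis
  have knz: "k z \<noteq> 0" if "cmod z < 1" for z
    using gnz[OF that] k(2)[OF that] k(3) g'0 by (cases "z = 0") auto
  \<comment> \<open>A logarithm of \<open>k z = g z / z\<close> turns the product \<open>Q\<close>
    into the sum \<open>L\<close>, so that \<open>cmod (Q z) = exp (Re (L z))\<close>.\<close>
  obtain l where l: "l holomorphic_on ball 0 1" "\<And>z. z \<in> ball 0 1 \<Longrightarrow> exp (l z) = k z"
    using holomorphic_logarithm_exists[OF convex_ball open_ball k(1), of 0] knz by auto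
  note dl = holomorphic_derivI[OF l(1) open_ball, of _ UNIV, simplified]
  \<comment> \<open>Order 1/2 in terms of \<open>l\<close>, because
    \<open>z * deriv g z / g z = 1 + z * deriv l z\<close>.\<close>
  have posl: "Re (z * deriv l z) > - 1/2" if z: "cmod z < 1" for z
  proof (cases "z = 0")
    case False
    have "((\<lambda>z. z * exp (l z)) has_field_derivative exp (l z) + z * (exp (l z) * deriv l z)) (at z)"
      using z by (auto intro!: derivative_eq_intros dl)
    then have "(g has_field_derivative exp (l z) + z * (exp (l z) * deriv l z)) (at z)"
      by (rule has_field_derivative_transform_within_open[OF _ open_ball[of 0 1]])
         (use z k(2) l(2) in auto)
    then have "deriv g z = k z * (1 + z * deriv l z)"
      using l(2)[of z] z by (simp add: DERIV_imp_deriv algebra_simps)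
    then have "z * deriv g z / g z = 1 + z * deriv l z"
      using k(2)[OF z] knz[OF z] False by simp
    then show ?thesis using gpos[OF z False] by simp
  qed simp
  define L where "L = (\<lambda>z. l z + l (- z))"
  define L' where "L' = (\<lambda>z. deriv l z - deriv l (- z))"
  define Q where "Q = (\<lambda>z. exp (L z))"
  have dlm: "((\<lambda>z. l (- z)) has_field_derivative - deriv l (- z)) (at z)" if "cmod z < 1" for z
  proof -
    have "(l has_field_derivative deriv l (- z)) (at (- z))" using dl[of "- z"] that by simp
    moreover have "(uminus has_field_derivative - 1) (at z)" by (rule DERIV_minus[OF DERIV_ident])
    ultimately show ?thesis using DERIV_chain2[of l "deriv l (- z)" uminus z "- 1" UNIV] by simp
  qed
  have dL: "(L has_field_derivative L' z) (at z)" if "cmod z < 1" for z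
    unfolding L_def L'_def using that
    by (auto intro!: derivative_eq_intros dl dlm)
  have dQ: "(Q has_field_derivative Q z * L' z) (at z)" if "cmod z < 1" for z
    unfolding Q_def using that by (auto intro!: derivative_eq_intros dL)
  have Q_eq: "Q z = k z * k (- z)" if "cmod z < 1" for z
    using l(2)[of z] l(2)[of "- z"] that by (simp add: Q_def L_def exp_add)
  have Q0: "Q 0 = 1" using Q_eq[of 0] k(3) g'0 by simp
  \<comment> \<open>This is \<open>z G' / G\<close>. Its derivative at 0 is \<open>L' 0\<close>,
    which vanishes because \<open>L'\<close> is odd.\<close>
  define h where "h = (\<lambda>z. 1 + z * L' z)"
  have hpos: "Re (h z) > 0" if "cmod z < 1" for z
    using posl[OF that] posl[of "- z"] that by (simp add: h_def L'_def algebra_simps)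
  have hol': "deriv l holomorphic_on ball 0 1" by (intro holomorphic_deriv l) auto
  have hol'': "(\<lambda>z. deriv l (- z)) holomorphic_on ball 0 1"
    using holomorphic_on_compose_gen[OF holomorphic_on_minus[OF holomorphic_on_ident] hol', of "ball 0 1"]
    by (simp add: o_def image_subset_iff)
  have holL': "L' holomorphic_on ball 0 1"
    unfolding L'_def by (intro holomorphic_intros hol' hol'')
  have holh: "h holomorphic_on ball 0 1"
    unfolding h_def by (intro holomorphic_intros holL')
  have "(L' has_field_derivative deriv L' 0) (at 0)"
    using holomorphic_derivI[OF holL' open_ball, of 0 UNIV] by simp
  moreover have "L' 0 = 0" by (simp add: L'_def)
  ultimately have "(h has_field_derivative 0) (at 0)"
    unfolding h_def by (auto intro!: derivative_eq_intros)
  then have dh: "deriv h 0 = 0" by (rule DERIV_imp_deriv)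
  have "h 0 = 1" by (simp add: h_def)
  note car = Caratheodory_second_order[OF holh this dh]
  have bounds: "- ln (1 + (cmod z)\<^sup>2) \<le> Re (L z)" "Re (L z) \<le> - ln (1 - (cmod z)\<^sup>2)"
    if z: "cmod z < 1" for z
  proof -
    define q where "q = (cmod z)\<^sup>2"
    have q: "0 \<le> q" "q < 1" using z by (auto simp: q_def power_less_one_iff abs_square_less_1)
    have tq: "t\<^sup>2 * q < 1" if "0 \<le> t" "t \<le> 1" for t
      using mult_mono[of "t\<^sup>2" 1 q q] that q by (simp add: power_le_one)
    have tq': "1 + t\<^sup>2 * q > 0" for t using q by (simp add: add_pos_nonneg)
    have small: "cmod (of_real t * z) < 1" if "0 \<le> t" "t \<le> 1" for t
      using mult_mono[of t 1 "cmod z" "cmod z"] that z by (simp add: norm_mult)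
    define R where "R = (\<lambda>t. Re (L (of_real t * z)))"
    define R' where "R' = (\<lambda>t. Re (z * L' (of_real t * z)))"
    have dR: "(R has_real_derivative R' t) (at t)" if t: "0 \<le> t" "t \<le> 1" for t
    proof -
      have "((\<lambda>t::real. of_real t * z) has_vector_derivative z) (at t)"
        by (auto intro!: derivative_eq_intros)
      from field_vector_diff_chain_at[OF this dL[OF small[OF t]]]
      have "((\<lambda>t. L (of_real t * z)) has_vector_derivative z * L' (of_real t * z)) (at t)"
        by (simp add: o_def)
      then show ?thesis unfolding R_def R'_def by (rule has_field_derivative_Re)
    qed
    \<comment> \<open>The Caratheodory bounds at the point \<open>t z\<close>, divided by
      \<open>t\<close>.\<close>
    have car_t: "- 2 * t * q / (1 + t\<^sup>2 * q) \<le> R' t"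
       "R' t \<le> 2 * t * q / (1 - t\<^sup>2 * q)" if t: "0 < t" "t < 1" for t
    proof -
      have eq: "Re (h (of_real t * z)) - 1 = t * R' t"
        by (simp add: h_def R'_def algebra_simps)
      have n: "(cmod (of_real t * z))\<^sup>2 = t * (t * q)"
        by (simp add: norm_mult q_def power2_eq_square)
      have s: "cmod (of_real t * z) < 1" using small t by simp
      have "t * (- 2 * t * q / (1 + t\<^sup>2 * q)) \<le> t * R' t"
           "t * R' t \<le> t * (2 * t * q / (1 - t\<^sup>2 * q))"
        using car[OF hpos s] unfolding eq n by (simp_all add: power2_eq_square mult_ac)
      then show "- 2 * t * q / (1 + t\<^sup>2 * q) \<le> R' t"
       "R' t \<le> 2 * t * q / (1 - t\<^sup>2 * q)"
        using t by (auto simp only: mult_le_cancel_left_pos)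
    qed
    \<comment> \<open>\<open>exp (L 0) = 1\<close> determines \<open>L 0\<close> up to a multiple of
      \<open>2 * pi * \<i>\<close>, hence determines its real part.\<close>
    have L0: "Re (L 0) = 0" using Q0 by (metis Q_def norm_exp_eq_Re norm_one exp_eq_one_iff)
    have contR: "continuous_on {0..1} R"
      by (intro continuous_at_imp_continuous_on ballI DERIV_isCont[OF dR]) auto
    \<comment> \<open>The logarithm is a primitive of
      \<open>2 * t * q / (1 + t\<^sup>2 * q)\<close>, so \<open>car_t\<close> makes \<open>A\<close>
      nondecreasing; \<open>B\<close> below integrates the upper bound likewise.\<close>
    define A where "A = (\<lambda>t. R t + ln (1 + t\<^sup>2 * q))"
    have "A 0 \<le> A 1"
    proof (rule DERIV_nonneg_imp_increasing_open[where f = A])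
      fix t :: real assume t: "0 < t" "t < 1"
      have "(A has_real_derivative R' t + 2 * t * q / (1 + t\<^sup>2 * q)) (at t)"
        unfolding A_def using t tq'[of t] by (auto intro!: derivative_eq_intros dR)
      with car_t(1)[OF t] show "\<exists>y. (A has_real_derivative y) (at t) \<and> y \<ge> 0" by fastforce
    next
      show "continuous_on {0..1} A"
        unfolding A_def using tq' by (intro continuous_intros contR) (auto simp: less_le)
    qed simp
    then show "- ln (1 + (cmod z)\<^sup>2) \<le> Re (L z)" using L0 by (simp add: A_def R_def q_def)
    define B where "B = (\<lambda>t. - R t - ln (1 - t\<^sup>2 * q))"
    have "B 0 \<le> B 1"
    proof (rule DERIV_nonneg_imp_increasing_open[where f = B])
      fix t :: real assume t: "0 < t" "t < 1"
      have "(B has_real_derivative - R' t + 2 * t * q / (1 - t\<^sup>2 * q)) (at t)"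
        unfolding B_def using t tq[of t] by (auto intro!: derivative_eq_intros dR)
      with car_t(2)[OF t] show "\<exists>y. (B has_real_derivative y) (at t) \<and> y \<ge> 0" by fastforce
    next
      show "continuous_on {0..1} B"
        unfolding B_def using tq by (intro continuous_intros contR) (force simp: less_le)
    qed simp
    then show "Re (L z) \<le> - ln (1 - (cmod z)\<^sup>2)" using L0 by (simp add: B_def R_def q_def)
  qed
  show ?thesis
  proof (rule that[of Q])
    show "Q holomorphic_on ball 0 1"
      using dQ holomorphic_on_open[of "ball 0 1" Q] by fastforce
    show "Q 0 = 1" by (rule Q0)
    fix z :: complex assume "z \<in> ball 0 1"
    then have z: "cmod z < 1" by simp
    show "Q z \<noteq> 0" by (simp add: Q_def)
    show "g z * g (- z) = - (z\<^sup>2 * Q z)"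
      using k(2)[OF z] k(2)[of "- z"] z Q_eq[OF z] by (simp add: power2_eq_square)
    have "1 + z * deriv Q z / Q z = h z"
      using DERIV_imp_deriv[OF dQ[OF z]] by (simp add: h_def Q_def)
    then show "Re (1 + z * deriv Q z / Q z) > 0" using hpos[OF z] by simp
    have "(cmod z)\<^sup>2 < 1" using z by (simp add: power_less_one_iff abs_square_less_1)
    then have "1 + (cmod z)\<^sup>2 > 0" "1 - (cmod z)\<^sup>2 > 0" by (auto simp: add_pos_nonneg)
    then have "exp (- ln (1 + (cmod z)\<^sup>2)) = 1 / (1 + (cmod z)\<^sup>2)"
      "exp (- ln (1 - (cmod z)\<^sup>2)) = 1 / (1 - (cmod z)\<^sup>2)"
      by (simp_all add: exp_minus inverse_eq_divide)
    then show "1 / (1 + (cmod z)\<^sup>2) \<le> cmod (Q z)" "cmod (Q z) \<le> 1 / (1 - (cmod z)\<^sup>2)"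
      using bounds[OF z] by (metis Q_def norm_exp_eq_Re exp_le_cancel_iff)+
  qed
qed

section \<open>Extremal functions and the factorization of the derivative\<close>

text \<open>The extremal functions: \<open>z\<^sup>2 / (g z g (- z)) = - (1 - a\<^sup>2 z\<^sup>2)\<close> for \<open>g z = z / (1 - a z)\<close>, and \<open>w z = z\<close>.\<close>

lemma Ks_class_extremal:
  assumes hol: "\<phi> holomorphic_on ball 0 1" and \<phi>0: "\<phi> 0 = 1" and a: "cmod a = 1"
  obtains f where "f \<in> Ks_class \<phi>" "\<And>z. cmod z < 1 \<Longrightarrow> deriv f z = \<phi> z / (1 - a\<^sup>2 * z\<^sup>2)"
proof -
  define g where "g = (\<lambda>z. z / (1 - a * z))"
  have nz: "1 - a * z \<noteq> 0" "1 + a * z \<noteq> 0" if "cmod z < 1" for z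
  proof -
    have "cmod (a * z) < 1" using that by (simp add: norm_mult a)
    then have "a * z \<noteq> 1" "a * z \<noteq> - 1" by auto
    then show "1 - a * z \<noteq> 0" "1 + a * z \<noteq> 0" by (auto simp: add_eq_0_iff)
  qed
  have eq: "(1 - a * z) * (1 + a * z) = 1 - a\<^sup>2 * z\<^sup>2" for z
    by (simp add: power2_eq_square algebra_simps)
  have nz2: "1 - a\<^sup>2 * z\<^sup>2 \<noteq> 0" if "cmod z < 1" for z
    using nz[OF that] by (simp flip: eq)
  have dg: "(g has_field_derivative 1 / (1 - a * z)\<^sup>2) (at z)" if "cmod z < 1" for z
    unfolding g_def using nz[OF that]
    by (auto intro!: derivative_eq_intros simp: power2_eq_square field_simps)
  have "g holomorphic_on ball 0 1"
    using dg holomorphic_on_open[of "ball 0 1" g] by fastforce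
  moreover have "g 0 = 0" by (simp add: g_def)
  moreover have "deriv g 0 = 1" using DERIV_imp_deriv[OF dg[of 0]] by simp
  moreover have "Re (if z = 0 then 1 else z * deriv g z / g z) > 1/2" if z: "cmod z < 1" for z
  proof (cases "z = 0")
    case False
    define y where "y = a * z"
    have y: "cmod y < 1" using z a by (simp add: y_def norm_mult)
    have "z * deriv g z / g z = 1 / (1 - y)"
      using DERIV_imp_deriv[OF dg[OF z]] nz[OF z] False by (simp add: g_def y_def power2_eq_square)
    \<comment> \<open>The map \<open>1 / (1 - y)\<close> takes the unit disc to this half-plane: the
      condition is \<open>(cmod (1 - y))\<^sup>2 < 2 * Re (1 - y)\<close>, that is
      \<open>cmod y < 1\<close>.\<close>
    also have "Re \<dots> > 1/2"
    proof -
      have "1 - y \<noteq> 0" using y by auto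
      then have pos: "(cmod (1 - y))\<^sup>2 > 0" by simp
      have "(cmod y)\<^sup>2 < 1" using y by (simp add: power_less_one_iff abs_square_less_1)
      then have "(cmod (1 - y))\<^sup>2 < 2 * Re (1 - y)"
        unfolding cmod_power2 by (simp add: power2_eq_square algebra_simps)
      moreover have "Re (1 / (1 - y)) = Re (1 - y) / (cmod (1 - y))\<^sup>2"
        by (simp add: Re_divide cmod_power2)
      ultimately show ?thesis using pos by (simp only: less_divide_eq) simp
    qed
    finally show ?thesis using False by (simp del: Re_divide)
  qed simp
  ultimately have gS: "g \<in> starlike_of_order (1/2)"
    unfolding starlike_of_order_def normalized_class_def mem_Collect_eq Ball_def mem_ball_0 by blast
  have "(\<lambda>z. \<phi> z / (1 - a\<^sup>2 * z\<^sup>2)) holomorphic_on ball 0 1"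
    using nz2 by (intro holomorphic_intros hol) auto
  then obtain F where F: "\<And>z. z \<in> ball 0 1 \<Longrightarrow> (F has_field_derivative \<phi> z / (1 - a\<^sup>2 * z\<^sup>2)) (at z within ball 0 1)"
    using holomorphic_convex_primitive'[OF convex_ball open_ball] by blast
  define f where "f = (\<lambda>z. F z - F 0)"
  have df: "(f has_field_derivative \<phi> z / (1 - a\<^sup>2 * z\<^sup>2)) (at z)" if "cmod z < 1" for z
    unfolding f_def using F[of z] that
    by (auto intro!: derivative_eq_intros simp: at_within_open[OF _ open_ball])
  note deriv_f = DERIV_imp_deriv[OF df]
  have "f holomorphic_on ball 0 1"
    using df holomorphic_on_open[of "ball 0 1" f] by fastforce
  moreover have "f 0 = 0" by (simp add: f_def)
  moreover have "deriv f 0 = 1" using deriv_f[of 0] \<phi>0 by simp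
  moreover have "(\<lambda>z. if z = 0 then 1 else - (z\<^sup>2 * deriv f z / (g z * g (- z)))) \<prec>\<^sub>s \<phi>"
    unfolding subordinate_def
  proof (intro exI[of _ "\<lambda>z. z"] conjI ballI)
    fix z :: complex assume "z \<in> ball 0 1"
    then have z: "cmod z < 1" by simp
    show "(if z = 0 then 1 else - (z\<^sup>2 * deriv f z / (g z * g (- z)))) = \<phi> z"
    proof (cases "z = 0")
      case False
      have "g z * g (- z) = - (z\<^sup>2 / (1 - a\<^sup>2 * z\<^sup>2))"
        unfolding eq[symmetric] by (simp add: g_def power2_eq_square)
      then show ?thesis using False nz2[OF z] by (simp add: deriv_f[OF z])
    qed (use \<phi>0 in simp)
  qed auto
  ultimately have "f \<in> Ks_class \<phi>" using gS by (auto simp: Ks_class_def normalized_class_def)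
  with deriv_f show ?thesis using that by blast
qed

text \<open>Substituting \<open>g z * g (- z) = - (z\<^sup>2 * Q z)\<close> into the subordination
  leaves \<open>deriv f z / Q z = \<phi> (w z)\<close>. Its positive real part makes
  \<open>f\<close> close-to-convex, hence injective.\<close>

lemma Ks_class_deriv_factorization:
  assumes f: "f \<in> Ks_class \<phi>" and \<phi>0: "\<phi> 0 = 1"
    and pos: "\<And>z. z \<in> ball 0 1 \<Longrightarrow> Re (\<phi> z) > 0"
  obtains w Q where "\<And>z. cmod z < 1 \<Longrightarrow> cmod (w z) \<le> cmod z"
    "\<And>z. cmod z < 1 \<Longrightarrow> deriv f z = \<phi> (w z) * Q z"
    "\<And>z. cmod z < 1 \<Longrightarrow> 1 / (1 + (cmod z)\<^sup>2) \<le> cmod (Q z)"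
    "\<And>z. cmod z < 1 \<Longrightarrow> cmod (Q z) \<le> 1 / (1 - (cmod z)\<^sup>2)"
    "inj_on f (ball 0 1)"
proof -
  obtain g where hol: "f holomorphic_on ball 0 1" and f'0: "deriv f 0 = 1"
    and g: "g \<in> starlike_of_order (1/2)"
    and sub: "(\<lambda>z. if z = 0 then 1 else - (z\<^sup>2 * deriv f z / (g z * g (- z)))) \<prec>\<^sub>s \<phi>"
    using f by (auto simp: Ks_class_def normalized_class_def)
  obtain w where w: "w holomorphic_on ball 0 1" "w 0 = 0" "\<And>z. cmod z < 1 \<Longrightarrow> cmod (w z) < 1"
    and w_eq: "\<And>z. cmod z < 1 \<Longrightarrow> (if z = 0 then 1 else - (z\<^sup>2 * deriv f z / (g z * g (- z)))) = \<phi> (w z)"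
    using sub unfolding subordinate_def by (metis mem_ball_0)
  obtain Q where Q: "Q holomorphic_on ball 0 1" "Q 0 = 1"
    "\<And>z. z \<in> ball 0 1 \<Longrightarrow> Q z \<noteq> 0"
    "\<And>z. z \<in> ball 0 1 \<Longrightarrow> g z * g (- z) = - (z\<^sup>2 * Q z)"
    "\<And>z. z \<in> ball 0 1 \<Longrightarrow> Re (1 + z * deriv Q z / Q z) > 0"
    "\<And>z. z \<in> ball 0 1 \<Longrightarrow> 1 / (1 + (cmod z)\<^sup>2) \<le> cmod (Q z)"
    "\<And>z. z \<in> ball 0 1 \<Longrightarrow> cmod (Q z) \<le> 1 / (1 - (cmod z)\<^sup>2)"
    using starlike_half_symmetrized[OF g] by metis
  have f': "deriv f z = \<phi> (w z) * Q z" if z: "cmod z < 1" for z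
  proof (cases "z = 0")
    case True
    then show ?thesis using f'0 w(2) \<phi>0 Q(2) by simp
  next
    case False
    then show ?thesis using w_eq[OF z] Q(3)[of z] Q(4)[of z] z by (auto simp: field_simps)
  qed
  have "inj_on f (ball 0 1)"
  proof (rule close_to_convex_imp_inj_on[OF hol Q(1,3) _ Q(5)])
    fix z :: complex assume z: "z \<in> ball 0 1"
    then have "deriv f z / Q z = \<phi> (w z)" using f'[of z] Q(3)[OF z] by simp
    then show "Re (deriv f z / Q z) > 0" using pos[of "w z"] w(3)[of z] z by simp
  qed
  with that[of w Q] f' Q(6,7) Schwarz_Lemma(1)[OF w] show ?thesis by simp
qed

section \<open>Distortion and growth bounds and their sharpness\<close>

theorem theorem3p1:
  fixes \<phi> :: "complex \<Rightarrow> complex"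
  assumes "\<phi> holomorphic_on ball 0 1"
    and "inj_on \<phi> (ball 0 1)"
    and "\<And>z. z \<in> ball 0 1 \<Longrightarrow> Re (\<phi> z) > 0"
    and "\<phi> 0 = 1"
    and "\<And>r::real. 0 \<le> r \<Longrightarrow> r < 1 \<Longrightarrow>
           \<phi> (- of_real r) = of_real (LEAST m. m \<in> (\<lambda>z. cmod (\<phi> z)) ` sphere 0 r)"
    and "\<And>r::real. 0 \<le> r \<Longrightarrow> r < 1 \<Longrightarrow>
           \<phi> (of_real r) = of_real (GREATEST m. m \<in> (\<lambda>z. cmod (\<phi> z)) ` sphere 0 r)"
  shows "(\<forall>f\<in>Ks_class \<phi>. \<forall>z\<in>ball 0 1. \<forall>r. r = cmod z \<longrightarrow>
            Re (\<phi> (- of_real r)) / (1 + r\<^sup>2) \<le> cmod (deriv f z) \<and>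
            cmod (deriv f z) \<le> Re (\<phi> (of_real r)) / (1 - r\<^sup>2) \<and>
            integral {0..r} (\<lambda>t. Re (\<phi> (- of_real t)) / (1 + t\<^sup>2)) \<le> cmod (f z) \<and>
            cmod (f z) \<le> integral {0..r} (\<lambda>t. Re (\<phi> (of_real t)) / (1 - t\<^sup>2))) \<and>
         (\<forall>r::real. 0 \<le> r \<and> r < 1 \<longrightarrow>
            (\<exists>f\<in>Ks_class \<phi>. \<exists>z. cmod z = r \<and>
               cmod (deriv f z) = Re (\<phi> (- of_real r)) / (1 + r\<^sup>2)) \<and>
            (\<exists>f\<in>Ks_class \<phi>. \<exists>z. cmod z = r \<and>
               cmod (deriv f z) = Re (\<phi> (of_real r)) / (1 - r\<^sup>2)) \<and>
            (\<exists>f\<in>Ks_class \<phi>. \<exists>z. cmod z = r \<and>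
               cmod (f z) = integral {0..r} (\<lambda>t. Re (\<phi> (- of_real t)) / (1 + t\<^sup>2))) \<and>
            (\<exists>f\<in>Ks_class \<phi>. \<exists>z. cmod z = r \<and>
               cmod (f z) = integral {0..r} (\<lambda>t. Re (\<phi> (of_real t)) / (1 - t\<^sup>2))))"
proof -
  note hol = assms(1) and pos = assms(3) and \<phi>0 = assms(4)
  have nz: "\<phi> z \<noteq> 0" if "z \<in> ball 0 1" for z using pos[OF that] by auto
  have extrema: "cmod (\<phi> \<zeta>) \<le> Re (\<phi> (of_real r))" "Re (\<phi> (- of_real r)) \<le> cmod (\<phi> \<zeta>)"
    if "cmod \<zeta> \<le> r" "r < 1" for \<zeta> r
    by (rule radial_extrema[OF hol nz assms(5,6) that]; assumption)+
  \<comment> \<open>The extremum hypotheses equate \<phi> at these points with real numbers, so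
    taking \<open>Re\<close> in the bounds loses nothing.\<close>
  have real: "\<phi> (- of_real t) = of_real (Re (\<phi> (- of_real t)))" "\<phi> (of_real t) = of_real (Re (\<phi> (of_real t)))"
    if "0 \<le> t" "t < 1" for t
    using assms(5,6)[OF that] by (metis Re_complex_of_real)+
  have pos_real: "Re (\<phi> (- of_real t)) > 0" "Re (\<phi> (of_real t)) > 0" if "0 \<le> t" "t < 1" for t
    using that by (auto intro!: pos)
  have sq: "1 - t\<^sup>2 > 0" "1 + t\<^sup>2 > 0" if "0 \<le> t" "t < 1" for t :: real
    using that by (auto simp: abs_square_less_1 add_pos_nonneg)
  define m where "m = (\<lambda>t. Re (\<phi> (- of_real t)) / (1 + t\<^sup>2))"
  define M where "M = (\<lambda>t. Re (\<phi> (of_real t)) / (1 - t\<^sup>2))"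
  have cont\<phi>: "continuous_on (ball 0 1) \<phi>" using hol by (rule holomorphic_on_imp_continuous_on)
  have contm: "continuous_on {0..<1} m"
    unfolding m_def using sq
    by (intro continuous_intros continuous_on_compose2[OF cont\<phi>]) (auto simp: less_le)
  have contM: "continuous_on {0..<1} M"
    unfolding M_def using sq
    by (intro continuous_intros continuous_on_compose2[OF cont\<phi>]) (auto simp: less_le)
  have nonneg: "m t \<ge> 0" "M t \<ge> 0" if "0 \<le> t" "t < 1" for t
    using pos_real[OF that] sq[OF that] by (auto simp: m_def M_def)
  have bounds: "m (cmod z) \<le> cmod (deriv f z)" "cmod (deriv f z) \<le> M (cmod z)"
    "integral {0..cmod z} m \<le> cmod (f z)" "cmod (f z) \<le> integral {0..cmod z} M"
    if f: "f \<in> Ks_class \<phi>" and z: "cmod z < 1" for f z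
  proof -
    have fh: "f holomorphic_on ball 0 1" "f 0 = 0"
      using f by (auto simp: Ks_class_def normalized_class_def)
    obtain w Q where wQ: "\<And>z. cmod z < 1 \<Longrightarrow> cmod (w z) \<le> cmod z"
      "\<And>z. cmod z < 1 \<Longrightarrow> deriv f z = \<phi> (w z) * Q z"
      "\<And>z. cmod z < 1 \<Longrightarrow> 1 / (1 + (cmod z)\<^sup>2) \<le> cmod (Q z)"
      "\<And>z. cmod z < 1 \<Longrightarrow> cmod (Q z) \<le> 1 / (1 - (cmod z)\<^sup>2)"
      and inj: "inj_on f (ball 0 1)"
      using Ks_class_deriv_factorization[OF f \<phi>0 pos] by metis
    have le: "m (cmod z) \<le> cmod (deriv f z)" "cmod (deriv f z) \<le> M (cmod z)" if z: "cmod z < 1" for z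
    proof -
      note ext = extrema[OF wQ(1)[OF z] z]
      have "Re (\<phi> (- of_real (cmod z))) * (1 / (1 + (cmod z)\<^sup>2)) \<le> cmod (\<phi> (w z)) * cmod (Q z)"
        using ext(2) wQ(3)[OF z] sq(2)[of "cmod z"] z by (intro mult_mono) auto
      then show "m (cmod z) \<le> cmod (deriv f z)" by (simp add: m_def wQ(2)[OF z] norm_mult)
      have "cmod (\<phi> (w z)) * cmod (Q z) \<le> Re (\<phi> (of_real (cmod z))) * (1 / (1 - (cmod z)\<^sup>2))"
        using ext(1) wQ(4)[OF z] pos_real(2)[of "cmod z"] z by (intro mult_mono) auto
      then show "cmod (deriv f z) \<le> M (cmod z)" by (simp add: M_def wQ(2)[OF z] norm_mult)
    qed
    show "m (cmod z) \<le> cmod (deriv f z)" "cmod (deriv f z) \<le> M (cmod z)" using le[OF z] by auto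
    show "integral {0..cmod z} m \<le> cmod (f z)"
      by (rule cmod_ge_integral_radial[OF fh inj contm nonneg(1) le(1) z])
    show "cmod (f z) \<le> integral {0..cmod z} M"
      by (rule cmod_le_integral_radial[OF fh contM le(2) z])
  qed
  \<comment> \<open>For \<open>a = 1\<close> the denominator at \<open>t\<close> is
    \<open>1 - t\<^sup>2\<close>, and \<phi> is largest there; for \<open>a = \<i>\<close> the
    denominator at \<open>- t\<close> is \<open>1 + t\<^sup>2\<close>, and \<phi> is smallest there.
    So \<open>f1\<close> attains both upper and \<open>f2\<close> both lower bounds.\<close>
  obtain f1 where f1: "f1 \<in> Ks_class \<phi>" "\<And>z. cmod z < 1 \<Longrightarrow> deriv f1 z = \<phi> z / (1 - 1\<^sup>2 * z\<^sup>2)"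
    using Ks_class_extremal[OF hol \<phi>0, of 1] by auto
  obtain f2 where f2: "f2 \<in> Ks_class \<phi>" "\<And>z. cmod z < 1 \<Longrightarrow> deriv f2 z = \<phi> z / (1 - \<i>\<^sup>2 * z\<^sup>2)"
    using Ks_class_extremal[OF hol \<phi>0, of \<i>] by auto
  \<comment> \<open>The factors 1 and - 1 are the directions \<open>u\<close> of the two radii, in
    the form that \<open>cmod_eq_integral_radial\<close> expects.\<close>
  have d1: "deriv f1 (of_real t * 1) = of_real (M t)" if "0 \<le> t" "t < 1" for t
    using f1(2)[of "of_real t"] real(2)[OF that] that by (simp add: M_def)
  have d2: "deriv f2 (of_real t * - 1) = of_real (m t)" if "0 \<le> t" "t < 1" for t
    using f2(2)[of "- of_real t"] real(1)[OF that] that by (simp add: m_def)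
  have sharp: "cmod (deriv f2 (of_real r * - 1)) = m r" "cmod (deriv f1 (of_real r * 1)) = M r"
    "cmod (f2 (of_real r * - 1)) = integral {0..r} m" "cmod (f1 (of_real r * 1)) = integral {0..r} M"
    if r: "0 \<le> r" "r < 1" for r
  proof -
    show "cmod (deriv f2 (of_real r * - 1)) = m r" "cmod (deriv f1 (of_real r * 1)) = M r"
      unfolding d1[OF r] d2[OF r] using nonneg[OF r] by simp_all
    show "cmod (f2 (of_real r * - 1)) = integral {0..r} m"
      using f2(1) by (intro cmod_eq_integral_radial[OF _ _ _ r contm d2 nonneg(1)])
        (auto simp: Ks_class_def normalized_class_def)
    show "cmod (f1 (of_real r * 1)) = integral {0..r} M"
      using f1(1) by (intro cmod_eq_integral_radial[OF _ _ _ r contM d1 nonneg(2)])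
        (auto simp: Ks_class_def normalized_class_def)
  qed
  have norms: "cmod (of_real r * - 1) = r" "cmod (of_real r * 1) = r" if "0 \<le> r" for r
    using that by simp_all
  have m_eq: "Re (\<phi> (- of_real t)) / (1 + t\<^sup>2) = m t" for t by (simp add: m_def)
  have M_eq: "Re (\<phi> (of_real t)) / (1 - t\<^sup>2) = M t" for t by (simp add: M_def)
  have "\<forall>f\<in>Ks_class \<phi>. \<forall>z\<in>ball 0 1. \<forall>r. r = cmod z \<longrightarrow>
      m r \<le> cmod (deriv f z) \<and> cmod (deriv f z) \<le> M r \<and>
      integral {0..r} m \<le> cmod (f z) \<and> cmod (f z) \<le> integral {0..r} M"
    using bounds by simp
  moreover have "\<forall>r. 0 \<le> r \<and> r < 1 \<longrightarrow>
      (\<exists>f\<in>Ks_class \<phi>. \<exists>z. cmod z = r \<and> cmod (deriv f z) = m r) \<and>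
      (\<exists>f\<in>Ks_class \<phi>. \<exists>z. cmod z = r \<and> cmod (deriv f z) = M r) \<and>
      (\<exists>f\<in>Ks_class \<phi>. \<exists>z. cmod z = r \<and> cmod (f z) = integral {0..r} m) \<and>
      (\<exists>f\<in>Ks_class \<phi>. \<exists>z. cmod z = r \<and> cmod (f z) = integral {0..r} M)"
    (is "\<forall>r. _ \<longrightarrow> ?P r")
  proof (intro allI impI)
    fix r :: real assume "0 \<le> r \<and> r < 1"
    then have r: "0 \<le> r" "r < 1" by auto
    note s = sharp[OF r] and n = norms[OF r(1)]
    have "\<exists>z. cmod z = r \<and> cmod (deriv f2 z) = m r" "\<exists>z. cmod z = r \<and> cmod (f2 z) = integral {0..r} m"
      by (rule exI[of _ "of_real r * - 1"], intro conjI n s)+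
    moreover have "\<exists>z. cmod z = r \<and> cmod (deriv f1 z) = M r" "\<exists>z. cmod z = r \<and> cmod (f1 z) = integral {0..r} M"
      by (rule exI[of _ "of_real r * 1"], intro conjI n s)+
    ultimately show "?P r" using f1(1) f2(1) by blast
  qed
  ultimately show ?thesis unfolding m_eq M_eq by (rule conjI)
qed

end
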